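(* Let $(X,d,\mu)$ be a quasi-metric-measure space. If $\mu(X)<\infty$, then for any $\alpha,p\in(0,\infty)$ and $\tilde p\in(0,p)$, the embedding $$M^{\alpha,p}(X,d,\mu)\hookrightarrow L^{\tilde p}(X,\mu)$$ is compact. On the other hand, if this embedding is continuous for some $p\in(0,\infty)$, $\tilde p\in(0,p)$, and $\alpha\in(0,\infty)$ with $\alpha\preceq\mathrm{ind}(X,d)$, then $\mu(X)<\infty$.
   Context: A quasi-metric space $(X,d)$ is a set $X$ with at least two elements and a function $d:X\times X\to[0,\infty)$ for which there are constants $C_0,C_1\in(0,\infty)$ such that for all $x,y,z\in X$: $d(x,y)=0$ iff $x=y$; $d(y,x)\le C_0 d(x,y)$; $d(x,y)\le C_1\max\{d(x,z),d(z,y)\}$ (symmetry is not required). For a quasi-metric $\rho$, $C_\rho:=\sup\frac{\rho(x,y)}{\max\{\rho(x,z),\rho(z,y)\}}\in[1,\infty)$, the supremum over all $x,y,z\in X$ not all equal. Balls are $B_d(x,r):=\{y\in X:d(x,y)<r\}$. The topology $\tau_d$ consists of all $\mathcal O\subseteq X$ such that for each $x\in\mathcal O$ there is $r>0$ with $B_d(x,r)\subseteq\mathcal O$. A quasi-metric-measure space $(X,d,\mu)$ is a quasi-metric space with a nonnegative measure $\mu$ on a $\sigma$-algebra containing the Borel sets of $\tau_d$, such that all $d$-balls are measurable and $\mu(B_d(x,r))\in(0,\infty)$ for all $x\in X$, $r\in(0,\infty)$. Quasi-metrics $d,\rho$ on $X$ are equivalent ($\rho\approx d$) if $\kappa^{-1}\rho\le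 d\le\kappa\rho$ on $X\times X$ for some constant $\kappa>0$. The lower smoothness index is $\mathrm{ind}(X,d):=\sup_{\rho\approx d}(\log_2 C_\rho)^{-1}\in(0,\infty]$ (with $1/0:=\infty$). The notation $\alpha\preceq\mathrm{ind}(X,d)$ means $\alpha\le\mathrm{ind}(X,d)$, where $\alpha=\mathrm{ind}(X,d)$ is permitted only when this supremum is attained. Hajłasz–Sobolev space: for $\alpha,p\in(0,\infty)$ and measurable $u:X\to\mathbb R$, $\mathcal D_d^\alpha(u)$ is the set of nonnegative measurable functions $g$ on $X$ for which there is a measurable $E\subseteq X$ with $\mu(E)=0$ and $|u(x)-u(y)|\le[d(x,y)]^\alpha(g(x)+g(y))$ for all $x,y\in X\setminus E$. $M^{\alpha,p}(X,d,\mu)$ is the set of $u\in L^p(X,\mu)$ with finite (quasi-)norm $\|u\|_{L^p(X,\mu)}+\inf_{g\in\mathcal D_d^\alpha(u)}\|g\|_{L^p(X,\mu)}$. An embedding is continuous if the inclusion is well defined and bounded for the (quasi-)norms; it is compact if it moreover maps bounded sets to totally bounded sets. *)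

theory Defs
  imports "HOL-Analysis.Analysis"
begin

section \<open>Quasi-metric spaces\<close>

definition quasi_metric_on :: "'a set \<Rightarrow> ('a \<Rightarrow> 'a \<Rightarrow> real) \<Rightarrow> bool" where
  "quasi_metric_on X d \<longleftrightarrow>
     (\<exists>x\<in>X. \<exists>y\<in>X. x \<noteq> y) \<and>
     (\<forall>x\<in>X. \<forall>y\<in>X. 0 \<le> d x y) \<and>
     (\<exists>C0>0. \<exists>C1>0. \<forall>x\<in>X. \<forall>y\<in>X. \<forall>z\<in>X.
        (d x y = 0 \<longleftrightarrow> x = y) \<and>
        d y x \<le> C0 * d x y \<and>
        d x y \<le> C1 * max (d x z) (d z y))"

(* For a quasi-metric the set below is nonempty and bounded above by any admissible C1,
   so that the real supremum is meaningful. *)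
definition quasi_metric_const :: "'a set \<Rightarrow> ('a \<Rightarrow> 'a \<Rightarrow> real) \<Rightarrow> real" where
  "quasi_metric_const X \<rho> =
     Sup {\<rho> x y / max (\<rho> x z) (\<rho> z y) | x y z.
            x \<in> X \<and> y \<in> X \<and> z \<in> X \<and> \<not> (x = y \<and> y = z)}"

definition qball :: "'a set \<Rightarrow> ('a \<Rightarrow> 'a \<Rightarrow> real) \<Rightarrow> 'a \<Rightarrow> real \<Rightarrow> 'a set" where
  "qball X d x r = {y \<in> X. d x y < r}"

definition quasi_metric_topology :: "'a set \<Rightarrow> ('a \<Rightarrow> 'a \<Rightarrow> real) \<Rightarrow> 'a topology" where
  "quasi_metric_topology X d =
     topology (\<lambda>U. U \<subseteq> X \<and> (\<forall>x\<in>U. \<exists>r>0. qball X d x r \<subseteq> U))"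

lemma openin_quasi_metric_topology:
  "openin (quasi_metric_topology X d) U \<longleftrightarrow>
     U \<subseteq> X \<and> (\<forall>x\<in>U. \<exists>r>0. qball X d x r \<subseteq> U)"
proof -
  have "istopology (\<lambda>U. U \<subseteq> X \<and> (\<forall>x\<in>U. \<exists>r>0. qball X d x r \<subseteq> U))" (is "istopology ?P")
    unfolding istopology_def
  proof (intro conjI allI impI)
    fix S T assume S: "?P S" and T: "?P T"
    show "S \<inter> T \<subseteq> X" using S by blast
    show "\<forall>x\<in>S \<inter> T. \<exists>r>0. qball X d x r \<subseteq> S \<inter> T"
    proof
      fix x assume "x \<in> S \<inter> T"
      then obtain r s where "r > 0" "qball X d x r \<subseteq> S" "s > 0" "qball X d x s \<subseteq> T"
        using S T by blast
      then have "min r s > 0 \<and> qball X d x (min r s) \<subseteq> S \<inter> T"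
        by (auto simp: qball_def)
      then show "\<exists>r>0. qball X d x r \<subseteq> S \<inter> T" by blast
    qed
  next
    fix K assume "\<forall>U\<in>K. ?P U"
    then show "\<Union>K \<subseteq> X" and "\<forall>x\<in>\<Union>K. \<exists>r>0. qball X d x r \<subseteq> \<Union>K"
      by blast (meson UnionE Union_upper \<open>\<forall>U\<in>K. ?P U\<close> subset_trans)
  qed
  then show ?thesis
    unfolding quasi_metric_topology_def by (simp add: topology_inverse')
qed

(* The underlying set X is space M. *)
definition quasi_metric_measure_space :: "'a measure \<Rightarrow> ('a \<Rightarrow> 'a \<Rightarrow> real) \<Rightarrow> bool" where
  "quasi_metric_measure_space M d \<longleftrightarrow>
     quasi_metric_on (space M) d \<and>
     sigma_sets (space M) {U. openin (quasi_metric_topology (space M) d) U} \<subseteq> sets M \<and>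
     (\<forall>x\<in>space M. \<forall>r>0. qball (space M) d x r \<in> sets M \<and>
        0 < emeasure M (qball (space M) d x r) \<and> emeasure M (qball (space M) d x r) < \<infinity>)"

section \<open>The lower smoothness index\<close>

definition quasi_metric_equiv ::
  "'a set \<Rightarrow> ('a \<Rightarrow> 'a \<Rightarrow> real) \<Rightarrow> ('a \<Rightarrow> 'a \<Rightarrow> real) \<Rightarrow> bool" where
  "quasi_metric_equiv X \<rho> d \<longleftrightarrow>
     (\<exists>\<kappa>>0. \<forall>x\<in>X. \<forall>y\<in>X. inverse \<kappa> * \<rho> x y \<le> d x y \<and> d x y \<le> \<kappa> * \<rho> x y)"

(* The inverse on ereal satisfies inverse 0 = \<infinity>. *)
definition smoothness_exponent :: "'a set \<Rightarrow> ('a \<Rightarrow> 'a \<Rightarrow> real) \<Rightarrow> ereal" where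
  "smoothness_exponent X \<rho> = inverse (ereal (log 2 (quasi_metric_const X \<rho>)))"

definition lower_smoothness_index :: "'a set \<Rightarrow> ('a \<Rightarrow> 'a \<Rightarrow> real) \<Rightarrow> ereal" where
  "lower_smoothness_index X d =
     (SUP \<rho>\<in>{\<rho>. quasi_metric_on X \<rho> \<and> quasi_metric_equiv X \<rho> d}. smoothness_exponent X \<rho>)"

definition admissible_smoothness :: "real \<Rightarrow> 'a set \<Rightarrow> ('a \<Rightarrow> 'a \<Rightarrow> real) \<Rightarrow> bool" where
  "admissible_smoothness \<alpha> X d \<longleftrightarrow>
     ereal \<alpha> \<le> lower_smoothness_index X d \<and>
     (ereal \<alpha> = lower_smoothness_index X d \<longrightarrow>
        (\<exists>\<rho>. quasi_metric_on X \<rho> \<and> quasi_metric_equiv X \<rho> d \<and>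
             smoothness_exponent X \<rho> = lower_smoothness_index X d))"

section \<open>Lebesgue and Hajlasz--Sobolev spaces\<close>

text \<open>
  Functions are not identified when they agree almost everywhere; the (quasi-)norms are therefore
  (quasi-)seminorms, and they take the value \<open>\<infinity>\<close> outside the respective space.
\<close>

definition Lp_norm :: "'a measure \<Rightarrow> real \<Rightarrow> ('a \<Rightarrow> real) \<Rightarrow> ennreal" where
  "Lp_norm M p u =
     (let I = (\<integral>\<^sup>+x. ennreal (\<bar>u x\<bar> powr p) \<partial>M)
      in if I = \<infinity> then \<infinity> else ennreal (enn2real I powr (1 / p)))"

definition Lp_space :: "'a measure \<Rightarrow> real \<Rightarrow> ('a \<Rightarrow> real) set" where
  "Lp_space M p = {u \<in> borel_measurable M. Lp_norm M p u < \<infinity>}"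

definition hajlasz_gradients ::
  "'a measure \<Rightarrow> ('a \<Rightarrow> 'a \<Rightarrow> real) \<Rightarrow> real \<Rightarrow> ('a \<Rightarrow> real) \<Rightarrow> ('a \<Rightarrow> real) set" where
  "hajlasz_gradients M d \<alpha> u =
     {g \<in> borel_measurable M. (\<forall>x\<in>space M. 0 \<le> g x) \<and>
        (\<exists>E\<in>null_sets M. \<forall>x\<in>space M - E. \<forall>y\<in>space M - E.
           \<bar>u x - u y\<bar> \<le> d x y powr \<alpha> * (g x + g y))}"

definition hajlasz_norm ::
  "'a measure \<Rightarrow> ('a \<Rightarrow> 'a \<Rightarrow> real) \<Rightarrow> real \<Rightarrow> real \<Rightarrow> ('a \<Rightarrow> real) \<Rightarrow> ennreal" where
  "hajlasz_norm M d \<alpha> p u = Lp_norm M p u + (INF g\<in>hajlasz_gradients M d \<alpha> u. Lp_norm M p g)"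

definition hajlasz_space ::
  "'a measure \<Rightarrow> ('a \<Rightarrow> 'a \<Rightarrow> real) \<Rightarrow> real \<Rightarrow> real \<Rightarrow> ('a \<Rightarrow> real) set" where
  "hajlasz_space M d \<alpha> p = {u \<in> Lp_space M p. hajlasz_norm M d \<alpha> p u < \<infinity>}"

section \<open>Embeddings of function spaces\<close>

definition continuous_embedding ::
  "('a \<Rightarrow> real) set \<Rightarrow> (('a \<Rightarrow> real) \<Rightarrow> ennreal) \<Rightarrow>
   ('a \<Rightarrow> real) set \<Rightarrow> (('a \<Rightarrow> real) \<Rightarrow> ennreal) \<Rightarrow> bool" where
  "continuous_embedding A nA B nB \<longleftrightarrow>
     A \<subseteq> B \<and> (\<exists>C\<ge>0. \<forall>u\<in>A. nB u \<le> ennreal C * nA u)"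

definition norm_bounded :: "(('a \<Rightarrow> real) \<Rightarrow> ennreal) \<Rightarrow> ('a \<Rightarrow> real) set \<Rightarrow> bool" where
  "norm_bounded n S \<longleftrightarrow> (\<exists>K\<ge>0. \<forall>u\<in>S. n u \<le> ennreal K)"

definition norm_totally_bounded ::
  "('a \<Rightarrow> real) set \<Rightarrow> (('a \<Rightarrow> real) \<Rightarrow> ennreal) \<Rightarrow> ('a \<Rightarrow> real) set \<Rightarrow> bool" where
  "norm_totally_bounded B n S \<longleftrightarrow>
     (\<forall>\<epsilon>>0. \<exists>F. finite F \<and> F \<subseteq> B \<and> (\<forall>u\<in>S. \<exists>f\<in>F. n (\<lambda>x. u x - f x) < ennreal \<epsilon>))"

definition compact_embedding ::
  "('a \<Rightarrow> real) set \<Rightarrow> (('a \<Rightarrow> real) \<Rightarrow> ennreal) \<Rightarrow>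
   ('a \<Rightarrow> real) set \<Rightarrow> (('a \<Rightarrow> real) \<Rightarrow> ennreal) \<Rightarrow> bool" where
  "compact_embedding A nA B nB \<longleftrightarrow>
     continuous_embedding A nA B nB \<and>
     (\<forall>S. S \<subseteq> A \<and> norm_bounded nA S \<longrightarrow> norm_totally_bounded B nB S)"

end

theory Submission
  imports Defs
begin

text \<open>
  \<^bold>\<open>Finite measure implies compactness.\<close> Disjoint balls have positive measure, so a finite
  total mass forces the space to be covered by countably many balls of any given radius
  (\<open>countable_ball_cover\<close>), and by finitely many up to a small remainder. A function \<open>u\<close> with
  gradient \<open>g\<close> is nearly constant on the part of a small ball where \<open>u\<close> and \<open>g\<close> are not large, so it
  is approximated there by a step function with values in a finite net. Outside the small
  remainder, the points where \<open>u\<close> or \<open>g\<close> is large contribute little to the \<open>q\<close>-th power, because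
  on them a \<open>q\<close>-th power is a small multiple of a \<open>p\<close>-th power. One finite set of step functions thus serves a whole bounded set
  (\<open>hajlasz_finite_net\<close>).

  \<^bold>\<open>Continuity implies finite measure.\<close> The assumption on \<open>\<alpha>\<close> yields a quasi-metric \<open>\<rho>\<close> equivalent to
  \<open>d\<close> for which \<open>\<rho> powr \<alpha>\<close> satisfies the quasi-triangle inequality with constant 2. By Frink's
  inequality (\<open>frink_chain_inequality\<close>) the infimum of the lengths of chains is comparable to it, which
  gives an \<open>\<alpha>\<close>-Hoelder function \<open>\<Phi>\<close> that grows like \<open>d x0 x powr \<alpha>\<close>
  (\<open>admissible_smoothness_Hoelder_distance\<close>). Let \<open>V t\<close> be the measure of the set where \<open>\<Phi> < t\<close>. For
  \<open>0 < e \<le> 1\<close>, a cutoff equal to \<open>1\<close> where \<open>\<Phi> < t\<close> and to \<open>0\<close> where \<open>\<Phi> \<ge> t + e\<close> turns the embedding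
  inequality into \<open>V t powr (1 / q) \<le> L / e * V (t + e) powr (1 / p)\<close>. A single use of it is
  compatible with very fast growth of \<open>V\<close>, but iterating it over infinitely many steps of total length
  1 is not: unless \<open>V t\<close> is below a constant, already \<open>V (t + 1)\<close> would be infinite
  (\<open>superlinear_iteration_bounded\<close>). Hence \<open>V\<close> is bounded, and so is the total mass.
\<close>

section \<open>Lebesgue quasi-norms\<close>

lemma powr_inverse_le_iff:
  fixes r c p :: real
  assumes "0 < p" "0 \<le> r" "0 \<le> c"
  shows "r powr (1 / p) \<le> c \<longleftrightarrow> r \<le> c powr p"
proof
  assume "r powr (1 / p) \<le> c"
  then have "(r powr (1 / p)) powr p \<le> c powr p"
    using assms by (intro powr_mono2) auto
  then show "r \<le> c powr p" using assms by (simp add: powr_powr)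
next
  assume "r \<le> c powr p"
  then have "r powr (1 / p) \<le> (c powr p) powr (1 / p)"
    using assms by (intro powr_mono2) auto
  then show "r powr (1 / p) \<le> c" using assms by (simp add: powr_powr)
qed

lemma powr_inverse_less_iff:
  fixes r c p :: real
  assumes "0 < p" "0 \<le> r" "0 \<le> c"
  shows "r powr (1 / p) < c \<longleftrightarrow> r < c powr p"
  using powr_inverse_le_iff[of "1 / p" c r] assms by (simp add: not_le[symmetric])

lemma Lp_norm_le_iff:
  assumes "0 < p" "0 \<le> c"
  shows "Lp_norm M p u \<le> ennreal c \<longleftrightarrow>
    (\<integral>\<^sup>+x. ennreal (\<bar>u x\<bar> powr p) \<partial>M) \<le> ennreal (c powr p)"
proof (cases "\<integral>\<^sup>+x. ennreal (\<bar>u x\<bar> powr p) \<partial>M" rule: ennreal_cases)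
  case (real r)
  then show ?thesis
    using assms by (simp add: Lp_norm_def ennreal_le_iff powr_inverse_le_iff)
next
  case top
  then show ?thesis by (simp add: Lp_norm_def top_unique)
qed

lemma Lp_norm_less_iff:
  assumes "0 < p" "0 < c"
  shows "Lp_norm M p u < ennreal c \<longleftrightarrow>
    (\<integral>\<^sup>+x. ennreal (\<bar>u x\<bar> powr p) \<partial>M) < ennreal (c powr p)"
proof (cases "\<integral>\<^sup>+x. ennreal (\<bar>u x\<bar> powr p) \<partial>M" rule: ennreal_cases)
  case (real r)
  then show ?thesis
    using assms by (simp add: Lp_norm_def ennreal_less_iff powr_inverse_less_iff)
next
  case top
  then show ?thesis by (simp add: Lp_norm_def)
qed

lemma Lp_norm_le_of_bounded_support:
  assumes "0 < p" "0 \<le> c" "A \<in> sets M" "emeasure M A < \<infinity>"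
    and "\<And>x. x \<in> space M \<Longrightarrow> \<bar>u x\<bar> \<le> c * indicator A x"
  shows "Lp_norm M p u \<le> ennreal (c * measure M A powr (1 / p))"
proof -
  have "(\<integral>\<^sup>+x. ennreal (\<bar>u x\<bar> powr p) \<partial>M)
      \<le> (\<integral>\<^sup>+x. ennreal (c powr p) * indicator A x \<partial>M)"
  proof (intro nn_integral_mono)
    fix x assume "x \<in> space M"
    then show "ennreal (\<bar>u x\<bar> powr p) \<le> ennreal (c powr p) * indicator A x"
      using assms(5)[of x] assms(1,2)
      by (cases "x \<in> A") (auto intro!: ennreal_leI powr_mono2)
  qed
  also have "\<dots> = ennreal (c powr p) * emeasure M A"
    using assms by (simp add: nn_integral_cmult_indicator)
  also have "\<dots> = ennreal ((c * measure M A powr (1 / p)) powr p)"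
    using assms by (simp add: emeasure_eq_ennreal_measure powr_mult powr_powr ennreal_mult)
  finally show ?thesis
    using assms by (subst Lp_norm_le_iff) auto
qed

lemma powr_le_of_large:
  fixes t h p q :: real
  assumes "0 < h" "h \<le> t" "q \<le> p"
  shows "t powr q \<le> h powr (q - p) * t powr p"
proof -
  have "t powr q = t powr (q - p) * t powr p"
    by (simp flip: powr_add)
  also have "\<dots> \<le> h powr (q - p) * t powr p"
    using assms by (intro mult_right_mono powr_mono2') auto
  finally show ?thesis .
qed

text \<open>
  Splitting at the height \<open>h\<close> replaces Hoelder's inequality: small values are controlled by the
  total mass, large ones by the \<open>p\<close>-th power.
\<close>
lemma powr_le_split:
  fixes t h p q :: real
  assumes "0 \<le> t" "0 < h" "0 < q" "q < p"
  shows "t powr q \<le> h powr q + h powr (q - p) * t powr p"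
proof (cases "t \<le> h")
  case True
  then have "t powr q \<le> h powr q" using assms by (intro powr_mono2) auto
  then show ?thesis by (simp add: add_increasing2)
next
  case False
  then have "t powr q \<le> h powr (q - p) * t powr p"
    using assms by (intro powr_le_of_large) auto
  then show ?thesis by (simp add: add_increasing)
qed

lemma Lp_norm_mono_exponent:
  assumes fin: "emeasure M (space M) < \<infinity>" and "0 < q" "q < p"
    and u: "u \<in> borel_measurable M"
  shows "Lp_norm M q u \<le> ennreal ((measure M (space M) + 1) powr (1 / q)) * Lp_norm M p u"
proof (cases "Lp_norm M p u" rule: ennreal_cases)
  case (real n)
  define C where "C = (measure M (space M) + 1) powr (1 / q)"
  have C: "C > 0" unfolding C_def by (simp add: add_nonneg_eq_0_iff measure_nonneg)
  \<comment> \<open>The splitting height has to be positive while \<open>n\<close> may be \<open>0\<close>, hence heights \<open>h > n\<close>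
    and a limit at the end.\<close>
  have bound: "Lp_norm M q u \<le> ennreal (C * h)" if h: "n < h" for h
  proof -
    have hp: "h > 0" using h real by linarith
    have Ip: "(\<integral>\<^sup>+x. ennreal (\<bar>u x\<bar> powr p) \<partial>M) \<le> ennreal (h powr p)"
      using Lp_norm_le_iff[of p h M u] real assms h hp by (simp add: ennreal_leI)
    have "(\<integral>\<^sup>+x. ennreal (\<bar>u x\<bar> powr q) \<partial>M)
      \<le> (\<integral>\<^sup>+x. ennreal (h powr q) + ennreal (h powr (q - p)) * ennreal (\<bar>u x\<bar> powr p) \<partial>M)"
      using powr_le_split[of "\<bar>u _\<bar>" h q p] assms hp
      by (intro nn_integral_mono) (simp add: ennreal_leI flip: ennreal_mult ennreal_plus)
    also have "\<dots> = ennreal (h powr q) * emeasure M (space M)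
        + ennreal (h powr (q - p)) * (\<integral>\<^sup>+x. ennreal (\<bar>u x\<bar> powr p) \<partial>M)"
      using u by (simp add: nn_integral_add nn_integral_cmult)
    also have "\<dots> \<le> ennreal (h powr q) * emeasure M (space M)
        + ennreal (h powr (q - p)) * ennreal (h powr p)"
      using Ip by (intro add_left_mono mult_left_mono) auto
    also have "\<dots> = ennreal (h powr q * measure M (space M) + h powr q)"
      using fin hp by (simp add: emeasure_eq_ennreal_measure flip: powr_add ennreal_mult ennreal_plus)
    also have "h powr q * measure M (space M) + h powr q = (C * h) powr q"
      using hp assms unfolding C_def by (simp add: powr_mult powr_powr algebra_simps)
    finally show ?thesis
      using assms C hp by (subst Lp_norm_le_iff) auto
  qed
  obtain m where m: "0 \<le> m" "Lp_norm M q u = ennreal m"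
    using bound[of "n + 1"] by (cases "Lp_norm M q u" rule: ennreal_cases) (auto simp: top_unique)
  have "m / C \<le> h" if "n < h" for h
  proof -
    have "m \<le> C * h" using bound[OF that] m C that real by (simp add: ennreal_le_iff)
    then show ?thesis using C by (simp add: field_simps)
  qed
  then have "m / C \<le> n" by (rule dense_ge)
  then have "m \<le> C * n" using C by (simp add: field_simps)
  then show ?thesis
    using m real C by (simp add: C_def ennreal_leI flip: ennreal_mult)
next
  case top
  have "(measure M (space M) + 1) powr (1 / q) > 0"
    by (simp add: add_nonneg_eq_0_iff measure_nonneg)
  then show ?thesis using top by (simp add: ennreal_mult_top)
qed

section \<open>Quasi-metrics\<close>

lemma quasi_metric_on_nonneg:
  "quasi_metric_on X d \<Longrightarrow> x \<in> X \<Longrightarrow> y \<in> X \<Longrightarrow> 0 \<le> d x y"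
  by (simp add: quasi_metric_on_def)

lemma quasi_metric_on_self:
  "quasi_metric_on X d \<Longrightarrow> x \<in> X \<Longrightarrow> d x x = 0"
  by (auto simp: quasi_metric_on_def)

lemma quasi_metric_onE:
  assumes "quasi_metric_on X d"
  obtains C0 C1 where "0 < C0" "0 < C1"
    "\<And>x y. x \<in> X \<Longrightarrow> y \<in> X \<Longrightarrow> d x y = 0 \<longleftrightarrow> x = y"
    "\<And>x y. x \<in> X \<Longrightarrow> y \<in> X \<Longrightarrow> d y x \<le> C0 * d x y"
    "\<And>x y z. x \<in> X \<Longrightarrow> y \<in> X \<Longrightarrow> z \<in> X \<Longrightarrow> d x y \<le> C1 * max (d x z) (d z y)"
proof -
  from assms obtain C0 C1 where "C0 > 0" "C1 > 0" and *: "\<forall>x\<in>X. \<forall>y\<in>X. \<forall>z\<in>X.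
        (d x y = 0 \<longleftrightarrow> x = y) \<and> d y x \<le> C0 * d x y \<and> d x y \<le> C1 * max (d x z) (d z y)"
    unfolding quasi_metric_on_def by blast
  show ?thesis by (rule that[of C0 C1]) (use \<open>C0 > 0\<close> \<open>C1 > 0\<close> * in blast)+
qed

text \<open>
  The two ways in which a quasi-metric that need not be symmetric is used: for balls that meet, and
  for points of the same ball.
\<close>
lemma quasi_metric_on_common_point:
  assumes "quasi_metric_on X d"
  obtains Q where "0 < Q"
    "\<And>x y z r. x \<in> X \<Longrightarrow> y \<in> X \<Longrightarrow> z \<in> X \<Longrightarrow> d x z < r \<Longrightarrow> d y z < r \<Longrightarrow> d x y < Q * r"
    "\<And>x y z r. x \<in> X \<Longrightarrow> y \<in> X \<Longrightarrow> z \<in> X \<Longrightarrow> d z x < r \<Longrightarrow> d z y < r \<Longrightarrow> d x y < Q * r"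
proof -
  obtain C0 C1 where C: "0 < C0" "0 < C1"
    and sym: "\<And>x y. x \<in> X \<Longrightarrow> y \<in> X \<Longrightarrow> d y x \<le> C0 * d x y"
    and quasi: "\<And>x y z. x \<in> X \<Longrightarrow> y \<in> X \<Longrightarrow> z \<in> X \<Longrightarrow> d x y \<le> C1 * max (d x z) (d z y)"
    using quasi_metric_onE[OF assms] by metis
  note nonneg = quasi_metric_on_nonneg[OF assms]
  have scale: "s < max 1 C0 * r" if "0 \<le> t" "t < r" "s \<le> t \<or> s \<le> C0 * t" for s t r
  proof -
    have "1 * t \<le> max 1 C0 * t" "C0 * t \<le> max 1 C0 * t"
      using that by (intro mult_right_mono; simp)+
    then have "s \<le> max 1 C0 * t" using that by auto
    also have "\<dots> < max 1 C0 * r" using that by (intro mult_strict_left_mono) auto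
    finally show ?thesis .
  qed
  show ?thesis
  proof (rule that[of "C1 * max 1 C0"])
    show "0 < C1 * max 1 C0" using C by simp
  next
    fix x y z r assume xyz: "x \<in> X" "y \<in> X" "z \<in> X" and "d x z < r" "d y z < r"
    then have "max (d x z) (d z y) < max 1 C0 * r"
      using scale[OF nonneg[of x z]] scale[OF nonneg[of y z]] sym[of y z] by auto
    then have "C1 * max (d x z) (d z y) < C1 * (max 1 C0 * r)"
      using C by (intro mult_strict_left_mono)
    then show "d x y < C1 * max 1 C0 * r" using quasi[OF xyz] by (simp add: mult.assoc)
  next
    fix x y z r assume xyz: "x \<in> X" "y \<in> X" "z \<in> X" and "d z x < r" "d z y < r"
    then have "max (d x z) (d z y) < max 1 C0 * r"
      using scale[OF nonneg[of z x]] scale[OF nonneg[of z y]] sym[of z x] by auto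
    then have "C1 * max (d x z) (d z y) < C1 * (max 1 C0 * r)"
      using C by (intro mult_strict_left_mono)
    then show "d x y < C1 * max 1 C0 * r" using quasi[OF xyz] by (simp add: mult.assoc)
  qed
qed

lemma quasi_metric_const_properties:
  assumes "quasi_metric_on X d"
  shows quasi_metric_const_ge_1: "1 \<le> quasi_metric_const X d"
    and quasi_metric_const_ineq: "\<And>x y z. x \<in> X \<Longrightarrow> y \<in> X \<Longrightarrow> z \<in> X \<Longrightarrow>
      d x y \<le> quasi_metric_const X d * max (d x z) (d z y)"
proof -
  obtain C0 C1 where C: "0 < C0" "0 < C1"
    and zero: "\<And>x y. x \<in> X \<Longrightarrow> y \<in> X \<Longrightarrow> d x y = 0 \<longleftrightarrow> x = y"
    and "\<And>x y. x \<in> X \<Longrightarrow> y \<in> X \<Longrightarrow> d y x \<le> C0 * d x y"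
    and quasi: "\<And>x y z. x \<in> X \<Longrightarrow> y \<in> X \<Longrightarrow> z \<in> X \<Longrightarrow> d x y \<le> C1 * max (d x z) (d z y)"
    using quasi_metric_onE[OF assms] by metis
  note nonneg = quasi_metric_on_nonneg[OF assms]
  let ?S = "{d x y / max (d x z) (d z y) | x y z. x \<in> X \<and> y \<in> X \<and> z \<in> X \<and> \<not> (x = y \<and> y = z)}"
  have pos: "0 < max (d x z) (d z y)" if "x \<in> X" "y \<in> X" "z \<in> X" "\<not> (x = y \<and> y = z)" for x y z
    using that zero[of x z] zero[of z y] nonneg[of x z] nonneg[of z y] by (auto simp: less_max_iff_disj)
  have bdd: "bdd_above ?S"
  proof (rule bdd_aboveI[of _ C1])
    fix s assume "s \<in> ?S"
    then obtain x y z where s: "s = d x y / max (d x z) (d z y)"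
      "x \<in> X" "y \<in> X" "z \<in> X" "\<not> (x = y \<and> y = z)" by blast
    then show "s \<le> C1" using quasi[of x y z] pos[of x z y] by (simp add: pos pos_divide_le_eq)
  qed
  obtain a b where ab: "a \<in> X" "b \<in> X" "a \<noteq> b"
    using assms by (auto simp: quasi_metric_on_def)
  have "d a b / max (d a b) (d b b) \<in> ?S" using ab by blast
  moreover have "d a b / max (d a b) (d b b) = 1"
    using ab zero[of a b] zero[of b b] nonneg[of a b] by (simp add: max_def)
  ultimately have "1 \<in> ?S" by simp
  then show "1 \<le> quasi_metric_const X d"
    unfolding quasi_metric_const_def using bdd by (rule cSup_upper)
  fix x y z assume xyz: "x \<in> X" "y \<in> X" "z \<in> X"
  show "d x y \<le> quasi_metric_const X d * max (d x z) (d z y)"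
  proof (cases "x = y \<and> y = z")
    case True
    then show ?thesis using xyz zero[of z z] by simp
  next
    case False
    then have "d x y / max (d x z) (d z y) \<in> ?S" using xyz by blast
    then have "d x y / max (d x z) (d z y) \<le> quasi_metric_const X d"
      unfolding quasi_metric_const_def using bdd by (rule cSup_upper)
    then show ?thesis using pos[OF xyz False] by (simp add: pos_divide_le_eq)
  qed
qed

section \<open>Compactness on spaces of finite measure\<close>

text \<open>
  Balls have positive measure, so a countable family of centres whose small balls fill as much
  measure as possible cannot be enlarged by a disjoint ball. Every further small ball therefore meets
  one of the family, and its centre lies in the corresponding larger ball.
\<close>
lemma countable_ball_cover:
  assumes qmms: "quasi_metric_measure_space M d" and fin: "emeasure M (space M) < \<infinity>" and r: "0 < r"
  obtains c :: "nat \<Rightarrow> 'a" where "\<And>i. c i \<in> space M" "\<And>x. x \<in> space M \<Longrightarrow> \<exists>i. d (c i) x < r"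
proof -
  have qm: "quasi_metric_on (space M) d"
    using qmms by (simp add: quasi_metric_measure_space_def)
  obtain x0 where x0: "x0 \<in> space M" using conjunct1[OF qm[unfolded quasi_metric_on_def]] by blast
  obtain Q where Q: "0 < Q" and common: "\<And>x y z r. x \<in> space M \<Longrightarrow> y \<in> space M \<Longrightarrow> z \<in> space M
      \<Longrightarrow> d x z < r \<Longrightarrow> d y z < r \<Longrightarrow> d x y < Q * r"
    using quasi_metric_on_common_point[OF qm] by metis
  \<comment> \<open>Two balls of radius \<open>r / Q\<close> that meet have centres at distance less than \<open>r\<close>.\<close>
  define B where "B a = qball (space M) d a (r / Q)" for a
  have B: "B a \<in> sets M" "0 < emeasure M (B a)" if "a \<in> space M" for a
    using qmms that r Q unfolding quasi_metric_measure_space_def B_def by auto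
  define U where "U A = (\<Union>a\<in>A. B a)" for A
  define \<A> where "\<A> = {A. A \<subseteq> space M \<and> countable A}"
  have U: "U A \<in> sets M" if "A \<in> \<A>" for A
    using that B unfolding U_def \<A>_def by (intro sets.countable_UN'') auto
  have "\<A> \<noteq> {}" unfolding \<A>_def by blast
  then obtain s :: "nat \<Rightarrow> ennreal" where s: "range s \<subseteq> (\<lambda>A. emeasure M (U A)) ` \<A>"
    and Sup_s: "(SUP A\<in>\<A>. emeasure M (U A)) = (SUP n. s n)"
    using ennreal_SUP_countable_SUP[of \<A> "\<lambda>A. emeasure M (U A)"] by blast
  have "\<forall>n. \<exists>A\<in>\<A>. s n = emeasure M (U A)" using s by (simp add: image_subset_iff image_iff)
  then obtain A where A: "\<And>n. A n \<in> \<A>" "\<And>n. s n = emeasure M (U (A n))" by metis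
  define A' where "A' = insert x0 (\<Union>n. A n)"
  have A': "A' \<in> \<A>" using A(1) x0 unfolding A'_def \<A>_def by auto
  have maximal: "emeasure M (U S) \<le> emeasure M (U A')" if "S \<in> \<A>" for S
  proof -
    have "emeasure M (U S) \<le> (SUP n. s n)"
      unfolding Sup_s[symmetric] using that by (rule SUP_upper)
    also have "\<dots> \<le> emeasure M (U A')"
      unfolding A(2) by (intro SUP_least emeasure_mono U A') (auto simp: U_def A'_def)
    finally show ?thesis .
  qed
  have cover: "\<exists>a\<in>A'. d a x < r" if x: "x \<in> space M" for x
  proof (rule ccontr)
    assume far: "\<not> ?thesis"
    have "B x \<inter> U A' = {}"
    proof (rule ccontr)
      assume "B x \<inter> U A' \<noteq> {}"
      then obtain a z where a: "a \<in> A'" "z \<in> B x" "z \<in> B a" by (auto simp: U_def)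
      then have "d a x < Q * (r / Q)"
        using A' x by (intro common[of a x z]) (auto simp: \<A>_def B_def qball_def)
      then show False using far a Q by auto
    qed
    moreover have "U (insert x A') = B x \<union> U A'" by (simp add: U_def)
    ultimately have "emeasure M (U (insert x A')) = emeasure M (B x) + emeasure M (U A')"
      using plus_emeasure[of "B x" M "U A'"] B[OF x] U[OF A'] by simp
    moreover have "insert x A' \<in> \<A>" using A' x by (simp add: \<A>_def)
    ultimately have "emeasure M (B x) + emeasure M (U A') \<le> 0 + emeasure M (U A')"
      using maximal[of "insert x A'"] by simp
    moreover have "emeasure M (U A') < \<infinity>"
      using emeasure_space[of M "U A'"] fin by (rule le_less_trans)
    ultimately show False using B(2)[OF x] by (auto simp: ennreal_add_left_cancel_le add.commute)
  qed
  have "countable A'" "A' \<noteq> {}" using A' by (auto simp: \<A>_def A'_def)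
  then have range: "range (from_nat_into A') = A'" by (rule range_from_nat_into[rotated])
  show ?thesis
  proof (rule that[of "from_nat_into A'"])
    show "from_nat_into A' i \<in> space M" for i
      using range A' unfolding \<A>_def by (metis (no_types, lifting) mem_Collect_eq rangeI subsetD)
    show "\<exists>i. d (from_nat_into A' i) x < r" if "x \<in> space M" for x
      using cover[OF that] range by (metis imageE)
  qed
qed

text \<open>
  The heart of compactness. Fix a height \<open>h\<close> and call a point good if \<open>\<bar>u\<bar>\<close> and \<open>g\<close> are at most
  \<open>h\<close> there. On the good points of a ball of radius \<open>r\<close> the function \<open>u\<close> oscillates by at most a
  multiple of \<open>h * r powr \<alpha>\<close>, so it is close to one value of a finite net of \<open>{-h..h}\<close>. Where \<open>\<bar>u\<bar>\<close>
  or \<open>g\<close> exceeds \<open>h\<close>, the error is bounded by \<open>h powr (q - p)\<close> times a \<open>p\<close>-th power, and this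
  factor tends to \<open>0\<close> as \<open>h\<close> grows because \<open>q < p\<close>. Finitely many of the countably many
  covering balls suffice up to a set of small measure, where steps are \<open>0\<close>.
\<close>
lemma hajlasz_finite_net:
  assumes qmms: "quasi_metric_measure_space M d" and fin: "emeasure M (space M) < \<infinity>"
    and q: "0 < q" "q < p" and \<alpha>: "0 < \<alpha>" and k: "0 < k" and e: "0 < e"
  obtains F where "finite F" "F \<subseteq> Lp_space M q"
    "\<And>u g. u \<in> borel_measurable M \<Longrightarrow> g \<in> hajlasz_gradients M d \<alpha> u \<Longrightarrow>
       (\<integral>\<^sup>+x. ennreal (\<bar>u x\<bar> powr p) \<partial>M) \<le> ennreal k \<Longrightarrow>
       (\<integral>\<^sup>+x. ennreal (\<bar>g x\<bar> powr p) \<partial>M) \<le> ennreal k \<Longrightarrow>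
       \<exists>f\<in>F. (\<integral>\<^sup>+x. ennreal (\<bar>u x - f x\<bar> powr q) \<partial>M) < ennreal e"
proof -
  interpret finite_measure M using fin by (intro finite_measureI) simp
  have qm: "quasi_metric_on (space M) d"
    using qmms by (simp add: quasi_metric_measure_space_def)
  define m where "m = measure M (space M)"
  have m: "0 \<le> m" by (simp add: m_def)
  \<comment> \<open>The height \<open>h\<close> makes the two terms with \<open>p\<close>-th powers at most \<open>e / 8\<close> each; then \<open>\<theta>\<close> makes
    the error on the good set at most \<open>e / 4\<close>; \<open>r\<close> makes the oscillation
    \<open>2 * h * (Q * r) powr \<alpha>\<close> on one piece equal to \<open>\<theta> / 2\<close>.\<close>
  define h where "h = (e / (8 * 2 powr q * k)) powr (1 / (q - p))"
  have h: "0 < h" using e k by (simp add: h_def)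
  have hqp: "h powr (q - p) = e / (8 * 2 powr q * k)"
    using q e k by (simp add: h_def powr_powr)
  define \<theta> where "\<theta> = (e / (4 * (m + 1))) powr (1 / q)"
  have \<theta>: "0 < \<theta>" "\<theta> powr q = e / (4 * (m + 1))"
    using e m q by (simp_all add: \<theta>_def powr_powr add_nonneg_eq_0_iff)
  obtain Q where Q: "0 < Q" and common: "\<And>x y z r. x \<in> space M \<Longrightarrow> y \<in> space M \<Longrightarrow> z \<in> space M
      \<Longrightarrow> d z x < r \<Longrightarrow> d z y < r \<Longrightarrow> d x y < Q * r"
    using quasi_metric_on_common_point[OF qm] by metis
  define r where "r = (\<theta> / (4 * h)) powr (1 / \<alpha>) / Q"
  have r: "0 < r" using \<theta> h Q by (simp add: r_def)
  have Qr: "(Q * r) powr \<alpha> = \<theta> / (4 * h)" using Q \<theta> h \<alpha> by (simp add: r_def powr_powr)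
  obtain c where c: "\<And>i::nat. c i \<in> space M" and cover: "\<And>x. x \<in> space M \<Longrightarrow> \<exists>i. d (c i) x < r"
    using countable_ball_cover[OF qmms fin r] by metis
  \<comment> \<open>The first ball containing a point; the level sets of this index partition the space.\<close>
  define idx where "idx x = (LEAST i. x \<in> qball (space M) d (c i) r)" for x
  have [measurable]: "qball (space M) d (c i) r \<in> sets M" for i
    using qmms c r unfolding quasi_metric_measure_space_def by blast
  have idx_meas[measurable]: "idx \<in> measurable M (count_space UNIV)"
    unfolding idx_def by measurable
  have idx: "d (c (idx x)) x < r" if "x \<in> space M" for x
  proof -
    have "\<exists>i. x \<in> qball (space M) d (c i) r" using cover[OF that] that by (simp add: qball_def)
    then have "x \<in> qball (space M) d (c (idx x)) r" unfolding idx_def by (rule LeastI_ex)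
    then show ?thesis by (simp add: qball_def)
  qed
  define N where "N n = {x \<in> space M. n \<le> idx x}" for n
  have N[measurable]: "N n \<in> sets M" for n unfolding N_def by measurable
  have "(\<lambda>n. measure M (N n)) \<longlonglongrightarrow> measure M (\<Inter>n. N n)"
    by (rule finite_Lim_measure_decseq) (auto simp: N_def decseq_def)
  moreover have "(\<Inter>n. N n) = {}"
  proof -
    have "x \<notin> N (Suc (idx x))" for x by (simp add: N_def)
    then show ?thesis by blast
  qed
  ultimately have "(\<lambda>n. measure M (N n)) \<longlonglongrightarrow> 0" by simp
  moreover have "0 < e / (4 * (2 * h) powr q)" using e h by simp
  ultimately have "\<forall>\<^sub>F n in sequentially. measure M (N n) < e / (4 * (2 * h) powr q)"
    by (rule order_tendstoD(2))
  then obtain n where "measure M (N n) < e / (4 * (2 * h) powr q)"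
    by (auto simp: eventually_sequentially)
  then have n: "(2 * h) powr q * measure M (N n) \<le> e / 4"
    using h by (simp add: field_simps)
  \<comment> \<open>The values are taken within \<open>{-h..h}\<close>, so that the steps obey the bound \<open>h\<close> themselves.\<close>
  have "\<exists>V. finite V \<and> V \<subseteq> {-h..h} \<and> {-h..h} \<subseteq> (\<Union>v\<in>V. ball v (\<theta> / 2))"
    using seq_compact_imp_totally_bounded[OF compact_imp_seq_compact[OF compact_Icc[of "-h" h]]] \<theta>
    by simp
  then obtain V where V: "finite V" "V \<subseteq> {-h..h}" "{-h..h} \<subseteq> (\<Union>v\<in>V. ball v (\<theta> / 2))"
    by blast
  define step where "step v x = (if idx x < n then v (idx x) else 0)" for v :: "nat \<Rightarrow> real" and x
  define F where "F = step ` (PiE {..<n} (\<lambda>_. V))"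
  have step_meas[measurable]: "step v \<in> borel_measurable M" for v
  proof -
    have "(\<lambda>x. (\<lambda>i. if i < n then v i else 0) (idx x)) \<in> borel_measurable M"
      by (rule measurable_compose[OF idx_meas]) simp
    then show ?thesis by (simp add: step_def[abs_def])
  qed
  have step_bound: "\<bar>step v x\<bar> \<le> h" if "\<And>i. i < n \<Longrightarrow> v i \<in> V" for v x
    using that V(2) h unfolding step_def by (force simp: abs_le_iff)
  show ?thesis
  proof (rule that[of F])
    show "finite F" unfolding F_def using V by (intro finite_imageI finite_PiE) auto
    show "F \<subseteq> Lp_space M q"
    proof
      fix f assume "f \<in> F"
      then obtain v where v: "v \<in> PiE {..<n} (\<lambda>_. V)" "f = step v" by (auto simp: F_def)
      have "Lp_norm M q f \<le> ennreal (h * measure M (space M) powr (1 / q))"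
        using q h fin step_bound[of v] v
        by (intro Lp_norm_le_of_bounded_support) (auto simp: PiE_iff)
      also have "\<dots> < \<infinity>" by simp
      finally show "f \<in> Lp_space M q" using v by (simp add: Lp_space_def)
    qed
  next
    fix u g assume u[measurable]: "u \<in> borel_measurable M" and g: "g \<in> hajlasz_gradients M d \<alpha> u"
      and Iu: "(\<integral>\<^sup>+x. ennreal (\<bar>u x\<bar> powr p) \<partial>M) \<le> ennreal k"
      and Ig: "(\<integral>\<^sup>+x. ennreal (\<bar>g x\<bar> powr p) \<partial>M) \<le> ennreal k"
    obtain E where E: "E \<in> null_sets M" and grad: "\<And>x y. x \<in> space M - E \<Longrightarrow> y \<in> space M - E
        \<Longrightarrow> \<bar>u x - u y\<bar> \<le> d x y powr \<alpha> * (g x + g y)"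
      and g0: "\<And>x. x \<in> space M \<Longrightarrow> 0 \<le> g x" and g_meas[measurable]: "g \<in> borel_measurable M"
      using g unfolding hajlasz_gradients_def by blast
    define G where "G = {x \<in> space M - E. \<bar>u x\<bar> \<le> h \<and> g x \<le> h}"
    have osc: "\<bar>u x - u y\<bar> \<le> \<theta> / 2" if x: "x \<in> G" and y: "y \<in> G" and xy: "idx x = idx y" for x y
    proof -
      have sp: "x \<in> space M" "y \<in> space M" using x y by (auto simp: G_def)
      have "d x y < Q * r"
        using idx[OF sp(1)] idx[OF sp(2)] xy by (intro common[OF sp c]) auto
      then have "d x y powr \<alpha> \<le> (Q * r) powr \<alpha>"
        using quasi_metric_on_nonneg[OF qm sp] \<alpha> by (intro powr_mono2) auto
      then have "d x y powr \<alpha> * (g x + g y) \<le> \<theta> / (4 * h) * (h + h)"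
        unfolding Qr using x y g0[OF sp(1)] g0[OF sp(2)] \<theta> h
        by (intro mult_mono add_mono) (auto simp: G_def)
      also have "\<dots> = \<theta> / 2" using h by (simp add: field_simps)
      finally show ?thesis using grad[of x y] x y by (simp add: G_def)
    qed
    have "\<exists>v\<in>V. \<forall>y\<in>G. idx y = i \<longrightarrow> \<bar>u y - v\<bar> \<le> \<theta>" for i
    proof (cases "\<exists>x\<in>G. idx x = i")
      case True
      then obtain x where x: "x \<in> G" "idx x = i" by blast
      then have "u x \<in> {-h..h}" by (auto simp: G_def)
      then obtain v where v: "v \<in> V" "\<bar>u x - v\<bar> < \<theta> / 2"
        using V(3) by (auto simp: dist_real_def subset_iff abs_minus_commute)
      have "\<bar>u y - v\<bar> \<le> \<theta>" if "y \<in> G" "idx y = i" for y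
        using osc[of x y] that x v by linarith
      then show ?thesis using v by blast
    next
      case False
      have "0 \<in> {-h..h}" using h by simp
      then show ?thesis using V(3) False by blast
    qed
    then obtain v where v: "\<And>i. v i \<in> V" "\<And>i y. y \<in> G \<Longrightarrow> idx y = i \<Longrightarrow> \<bar>u y - v i\<bar> \<le> \<theta>" by metis
    define f where "f = step (restrict v {..<n})"
    have fF: "f \<in> F" unfolding f_def F_def using v(1) by (intro imageI restrict_PiE_iff[THEN iffD2]) simp
    have f_bound: "\<bar>f x\<bar> \<le> h" for x unfolding f_def by (rule step_bound) (simp add: v)
    have [measurable]: "f \<in> borel_measurable M" by (simp add: f_def)
    let ?b = "2 powr q * h powr (q - p)"
    have pointwise: "\<bar>u x - f x\<bar> powr q \<le> \<theta> powr q + (2 * h) powr q * indicator (N n) x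
        + ?b * \<bar>u x\<bar> powr p + ?b * \<bar>g x\<bar> powr p" if x: "x \<in> space M - E" for x
    proof -
      consider (large_u) "h \<le> \<bar>u x\<bar>" | (large_g) "\<bar>u x\<bar> \<le> h" "h \<le> \<bar>g x\<bar>"
        | (good) "\<bar>u x\<bar> \<le> h" "g x \<le> h" by linarith
      then show ?thesis
      proof cases
        case large_u
        have "\<bar>u x - f x\<bar> powr q \<le> (2 * \<bar>u x\<bar>) powr q"
          using large_u f_bound[of x] q by (intro powr_mono2) auto
        also have "\<dots> = 2 powr q * \<bar>u x\<bar> powr q" by (simp add: powr_mult)
        also have "\<dots> \<le> 2 powr q * (h powr (q - p) * \<bar>u x\<bar> powr p)"
          using large_u q h by (intro mult_left_mono powr_le_of_large) auto
        also have "\<dots> = ?b * \<bar>u x\<bar> powr p" by simp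
        finally show ?thesis by (simp add: add_increasing add_increasing2)
      next
        case large_g
        have "\<bar>u x - f x\<bar> powr q \<le> (2 * \<bar>g x\<bar>) powr q"
          using large_g f_bound[of x] q by (intro powr_mono2) auto
        also have "\<dots> = 2 powr q * \<bar>g x\<bar> powr q" by (simp add: powr_mult)
        also have "\<dots> \<le> 2 powr q * (h powr (q - p) * \<bar>g x\<bar> powr p)"
          using large_g q h by (intro mult_left_mono powr_le_of_large) auto
        also have "\<dots> = ?b * \<bar>g x\<bar> powr p" by simp
        finally show ?thesis by (simp add: add_increasing add_increasing2)
      next
        case good
        then have "x \<in> G" using x by (simp add: G_def)
        have "\<bar>u x - f x\<bar> powr q \<le> \<theta> powr q + (2 * h) powr q * indicator (N n) x"
        proof (cases "idx x < n")
          case True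
          then have "\<bar>u x - f x\<bar> \<le> \<theta>" using v(2)[OF \<open>x \<in> G\<close> refl] by (simp add: f_def step_def)
          then have "\<bar>u x - f x\<bar> powr q \<le> \<theta> powr q" using q by (intro powr_mono2) auto
          then show ?thesis by (simp add: add_increasing2)
        next
          case False
          then have "x \<in> N n" using x by (simp add: N_def)
          moreover have "\<bar>u x - f x\<bar> powr q \<le> (2 * h) powr q"
            using good f_bound[of x] q by (intro powr_mono2) auto
          ultimately show ?thesis by (simp add: add_increasing)
        qed
        then show ?thesis by (simp add: add_increasing2)
      qed
    qed
    have b: "0 \<le> ?b" by simp
    have "(\<integral>\<^sup>+x. ennreal (\<bar>u x - f x\<bar> powr q) \<partial>M)
        \<le> (\<integral>\<^sup>+x. ennreal (\<theta> powr q) + ennreal ((2 * h) powr q) * indicator (N n) x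
            + ennreal ?b * ennreal (\<bar>u x\<bar> powr p) + ennreal ?b * ennreal (\<bar>g x\<bar> powr p) \<partial>M)"
    proof (rule nn_integral_mono_AE, rule AE_I'[OF E], rule subsetI, rule ccontr)
      fix x assume "x \<in> {x \<in> space M. \<not> ennreal (\<bar>u x - f x\<bar> powr q) \<le> ennreal (\<theta> powr q)
          + ennreal ((2 * h) powr q) * indicator (N n) x
          + ennreal ?b * ennreal (\<bar>u x\<bar> powr p) + ennreal ?b * ennreal (\<bar>g x\<bar> powr p)}"
        and "x \<notin> E"
      then have x: "x \<in> space M - E" and *: "\<not> ennreal (\<bar>u x - f x\<bar> powr q) \<le> ennreal (\<theta> powr q)
          + ennreal ((2 * h) powr q) * indicator (N n) x
          + ennreal ?b * ennreal (\<bar>u x\<bar> powr p) + ennreal ?b * ennreal (\<bar>g x\<bar> powr p)" by auto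
      have "ennreal ((2 * h) powr q) * indicator (N n) x
          = ennreal ((2 * h) powr q * indicator (N n) x)" by (simp add: indicator_def)
      then show False
        using * ennreal_leI[OF pointwise[OF x]] by (simp add: ennreal_mult ennreal_plus)
    qed
    also have "\<dots> = ennreal (\<theta> powr q) * emeasure M (space M) + ennreal ((2 * h) powr q) * emeasure M (N n)
        + ennreal ?b * (\<integral>\<^sup>+x. ennreal (\<bar>u x\<bar> powr p) \<partial>M)
        + ennreal ?b * (\<integral>\<^sup>+x. ennreal (\<bar>g x\<bar> powr p) \<partial>M)"
      by (simp add: nn_integral_add nn_integral_cmult nn_integral_cmult_indicator)
    also have "\<dots> \<le> ennreal (\<theta> powr q) * emeasure M (space M) + ennreal ((2 * h) powr q) * emeasure M (N n)
        + ennreal ?b * ennreal k + ennreal ?b * ennreal k"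
      using Iu Ig by (intro add_mono mult_left_mono order_refl) auto
    also have "\<dots> = ennreal (\<theta> powr q * m + (2 * h) powr q * measure M (N n) + ?b * k + ?b * k)"
      using k by (simp add: emeasure_eq_measure m_def flip: ennreal_mult ennreal_plus)
    also have "\<dots> < ennreal e"
    proof (rule ennreal_lessI[OF e])
      have "?b * k = e / 8" using hqp k by (simp add: field_simps)
      moreover have "\<theta> powr q * m \<le> e / 4"
        unfolding \<theta>(2) using e m by (simp add: field_simps)
      ultimately show "\<theta> powr q * m + (2 * h) powr q * measure M (N n) + ?b * k + ?b * k < e"
        using n e by linarith
    qed
    finally show "\<exists>f\<in>F. (\<integral>\<^sup>+x. ennreal (\<bar>u x - f x\<bar> powr q) \<partial>M) < ennreal e"
      using fF by blast
  qed
qed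

text \<open>
  The infimum over gradients need not be attained, so the net is built for the bound \<open>K + 1\<close>.
\<close>
lemma compact_embedding_of_finite_measure:
  assumes qmms: "quasi_metric_measure_space M d" and fin: "emeasure M (space M) < \<infinity>"
    and q: "0 < q" "q < p" and \<alpha>: "0 < \<alpha>"
  shows "compact_embedding (hajlasz_space M d \<alpha> p) (hajlasz_norm M d \<alpha> p) (Lp_space M q) (Lp_norm M q)"
  unfolding compact_embedding_def continuous_embedding_def
proof (intro conjI allI impI)
  let ?C = "(measure M (space M) + 1) powr (1 / q)"
  have bound: "Lp_norm M q u \<le> ennreal ?C * hajlasz_norm M d \<alpha> p u" if "u \<in> hajlasz_space M d \<alpha> p" for u
  proof -
    have "Lp_norm M q u \<le> ennreal ?C * Lp_norm M p u"
      using that fin q by (intro Lp_norm_mono_exponent) (auto simp: hajlasz_space_def Lp_space_def)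
    also have "\<dots> \<le> ennreal ?C * hajlasz_norm M d \<alpha> p u"
      unfolding hajlasz_norm_def by (intro mult_left_mono) auto
    finally show ?thesis .
  qed
  then show "\<exists>C\<ge>0. \<forall>u\<in>hajlasz_space M d \<alpha> p. Lp_norm M q u \<le> ennreal C * hajlasz_norm M d \<alpha> p u"
    by (intro exI[of _ ?C]) auto
  show "hajlasz_space M d \<alpha> p \<subseteq> Lp_space M q"
  proof
    fix u assume u: "u \<in> hajlasz_space M d \<alpha> p"
    then have "ennreal ?C * hajlasz_norm M d \<alpha> p u < \<infinity>"
      by (simp add: hajlasz_space_def ennreal_mult_less_top)
    with bound[OF u] have "Lp_norm M q u < \<infinity>" by (rule le_less_trans)
    then show "u \<in> Lp_space M q" using u by (simp add: hajlasz_space_def Lp_space_def)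
  qed
  fix S assume S: "S \<subseteq> hajlasz_space M d \<alpha> p \<and> norm_bounded (hajlasz_norm M d \<alpha> p) S"
  then obtain K where K: "0 \<le> K" "\<And>u. u \<in> S \<Longrightarrow> hajlasz_norm M d \<alpha> p u \<le> ennreal K"
    unfolding norm_bounded_def by blast
  show "norm_totally_bounded (Lp_space M q) (Lp_norm M q) S"
    unfolding norm_totally_bounded_def
  proof (intro allI impI)
    fix e :: real assume e: "0 < e"
    have kpos: "0 < (K + 1) powr p" and epos: "0 < e powr q" using K e by auto
    obtain F where F: "finite F" "F \<subseteq> Lp_space M q" and
      net: "\<And>u g. u \<in> borel_measurable M \<Longrightarrow> g \<in> hajlasz_gradients M d \<alpha> u \<Longrightarrow>
       (\<integral>\<^sup>+x. ennreal (\<bar>u x\<bar> powr p) \<partial>M) \<le> ennreal ((K + 1) powr p) \<Longrightarrow>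
       (\<integral>\<^sup>+x. ennreal (\<bar>g x\<bar> powr p) \<partial>M) \<le> ennreal ((K + 1) powr p) \<Longrightarrow>
       \<exists>f\<in>F. (\<integral>\<^sup>+x. ennreal (\<bar>u x - f x\<bar> powr q) \<partial>M) < ennreal (e powr q)"
      by (rule hajlasz_finite_net[OF qmms fin q \<alpha> kpos epos]) (rule that, assumption+)
    have "\<exists>f\<in>F. Lp_norm M q (\<lambda>x. u x - f x) < ennreal e" if u: "u \<in> S" for u
    proof -
      have um: "u \<in> borel_measurable M" using S u by (auto simp: hajlasz_space_def Lp_space_def)
      have "hajlasz_norm M d \<alpha> p u < ennreal (K + 1)"
        using K(2)[OF u] K(1) by (auto intro: le_less_trans simp: ennreal_less_iff)
      then have less: "Lp_norm M p u < ennreal (K + 1)"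
        "(INF g\<in>hajlasz_gradients M d \<alpha> u. Lp_norm M p g) < ennreal (K + 1)"
        unfolding hajlasz_norm_def by (auto intro: le_less_trans[rotated])
      then obtain g where g: "g \<in> hajlasz_gradients M d \<alpha> u" "Lp_norm M p g < ennreal (K + 1)"
        unfolding INF_less_iff by blast
      have "\<exists>f\<in>F. (\<integral>\<^sup>+x. ennreal (\<bar>u x - f x\<bar> powr q) \<partial>M) < ennreal (e powr q)"
        using less(1) g(2) K q by (intro net[OF um g(1)]; subst Lp_norm_le_iff[symmetric]) auto
      then show ?thesis using Lp_norm_less_iff[OF q(1) e] by auto
    qed
    then show "\<exists>F. finite F \<and> F \<subseteq> Lp_space M q \<and> (\<forall>u\<in>S. \<exists>f\<in>F. Lp_norm M q (\<lambda>x. u x - f x) < ennreal e)"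
      using F by blast
  qed
qed

section \<open>Distances defined by chains\<close>

text \<open>
  Frink's chain inequality. Counting the two end links only twice, instead of four times, is what
  makes the induction close: when a chain is split, the middle link belongs to both halves. A chain
  of one link violates this sharper form, hence \<open>a + 2 \<le> b\<close>.
\<close>
lemma frink_chain_inequality:
  fixes D :: "'a \<Rightarrow> 'a \<Rightarrow> real"
  assumes nonneg: "\<And>x y. x \<in> X \<Longrightarrow> y \<in> X \<Longrightarrow> 0 \<le> D x y"
    and quasi: "\<And>x y z. x \<in> X \<Longrightarrow> y \<in> X \<Longrightarrow> z \<in> X \<Longrightarrow> D x y \<le> 2 * max (D x z) (D z y)"
    and f: "\<And>i. f i \<in> X"
  shows "a + 2 \<le> b \<Longrightarrow> D (f a) (f b) + 2 * D (f a) (f (Suc a)) + 2 * D (f (b - 1)) (f b)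
    \<le> 4 * (\<Sum>i\<in>{a..<b}. D (f i) (f (Suc i)))"
proof (induction "b - a" arbitrary: a b rule: less_induct)
  case less
  let ?T = "D (f a) (f b)"
  have split_ends: "(\<Sum>i\<in>{a..<b}. D (f i) (f (Suc i)))
      = D (f a) (f (Suc a)) + (\<Sum>i\<in>{Suc a..<b - 1}. D (f i) (f (Suc i))) + D (f (b - 1)) (f b)"
  proof -
    obtain c where c: "b = Suc c" "a < c" using less.prems by (cases b) auto
    then show ?thesis by (simp add: sum.atLeast_Suc_lessThan)
  qed
  have mid: "0 \<le> (\<Sum>i\<in>{Suc a..<b - 1}. D (f i) (f (Suc i)))"
    by (intro sum_nonneg nonneg f)
  \<comment> \<open>The largest \<open>i\<close> from which the remaining piece is at least half of the whole: then
    the piece up to \<open>i\<close> and one more step is also at least half, so the two pieces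
    together dominate the whole with constant 1.\<close>
  define P where "P i \<longleftrightarrow> i < b \<and> a \<le> i \<and> ?T \<le> 2 * D (f i) (f b)" for i
  have Pa: "P a" using less.prems nonneg[OF f f, of a b] by (simp add: P_def)
  define i where "i = (GREATEST i. P i)"
  have Pi: "P i" unfolding i_def by (rule GreatestI_nat[where P = P and b = b, OF Pa]) (simp add: P_def)
  have imax: "k \<le> i" if "P k" for k
    unfolding i_def by (rule Greatest_le_nat[where P = P and b = b, OF that]) (simp add: P_def)
  show ?case
  proof (cases "i = b - 1")
    case True
    then have "?T \<le> 2 * D (f (b - 1)) (f b)" using Pi by (simp add: P_def)
    then show ?thesis using split_ends mid nonneg[OF f f, of a "Suc a"] by linarith
  next
    case False
    then have i: "a \<le> i" "Suc i < b" using Pi by (auto simp: P_def)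
    have "\<not> P (Suc i)" using imax[of "Suc i"] by auto
    then have "2 * D (f (Suc i)) (f b) < ?T" using i by (auto simp: P_def)
    then have T1: "?T \<le> 2 * D (f a) (f (Suc i))"
      using quasi[OF f f f, of a b "Suc i"] by (auto simp: max_def split: if_splits)
    show ?thesis
    proof (cases "i = a")
      case True
      then show ?thesis
        using T1 split_ends mid nonneg[OF f f, of "b - 1" b] nonneg[OF f f, of a "Suc a"] by simp
    next
      case False
      then have ai: "a < i" using i by simp
      have 1: "D (f a) (f (Suc i)) + 2 * D (f a) (f (Suc a)) + 2 * D (f i) (f (Suc i))
          \<le> 4 * (\<Sum>j\<in>{a..<Suc i}. D (f j) (f (Suc j)))"
        using less.hyps[of "Suc i" a] ai i by simp
      have 2: "D (f i) (f b) + 2 * D (f i) (f (Suc i)) + 2 * D (f (b - 1)) (f b)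
          \<le> 4 * (\<Sum>j\<in>{i..<b}. D (f j) (f (Suc j)))"
        using less.hyps[of b i] ai i by simp
      have 3: "(\<Sum>j\<in>{a..<i}. D (f j) (f (Suc j))) + (\<Sum>j\<in>{i..<b}. D (f j) (f (Suc j)))
          = (\<Sum>j\<in>{a..<b}. D (f j) (f (Suc j)))"
        using ai i by (intro sum.atLeastLessThan_concat) auto
      have 4: "(\<Sum>j\<in>{a..<Suc i}. D (f j) (f (Suc j)))
          = (\<Sum>j\<in>{a..<i}. D (f j) (f (Suc j))) + D (f i) (f (Suc i))"
        using ai by simp
      have "?T \<le> D (f a) (f (Suc i)) + D (f i) (f b)"
        using T1 Pi by (simp add: P_def)
      then show ?thesis using 1 2 3 4 by linarith
    qed
  qed
qed

text \<open>
  Links are indexed by a function on all natural numbers of which only the first \<open>n + 1\<close> values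
  matter; keeping all values in \<open>X\<close> spares side conditions.
\<close>
definition chain_dist :: "'a set \<Rightarrow> ('a \<Rightarrow> 'a \<Rightarrow> real) \<Rightarrow> 'a \<Rightarrow> 'a \<Rightarrow> real" where
  "chain_dist X D x y =
     Inf {\<Sum>i<n. D (f i) (f (Suc i)) | f n. f 0 = x \<and> f n = y \<and> (\<forall>i. f i \<in> X)}"

context
  fixes X :: "'a set" and D :: "'a \<Rightarrow> 'a \<Rightarrow> real"
  assumes D_nonneg: "\<And>x y. x \<in> X \<Longrightarrow> y \<in> X \<Longrightarrow> 0 \<le> D x y"
begin

lemma chain_sums_bdd_below:
  "bdd_below {\<Sum>i<n. D (f i) (f (Suc i)) | f n. f 0 = x \<and> f n = y \<and> (\<forall>i. f i \<in> X)}"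
  by (rule bdd_belowI[of _ 0]) (auto intro!: sum_nonneg D_nonneg)

lemma chain_sums_nonempty:
  assumes "x \<in> X" "y \<in> X"
  shows "{\<Sum>i<n. D (f i) (f (Suc i)) | f n. f 0 = x \<and> f n = y \<and> (\<forall>i. f i \<in> X)} \<noteq> {}"
proof -
  let ?f = "\<lambda>i::nat. if i = 0 then x else y"
  have "(\<Sum>i<1. D (?f i) (?f (Suc i)))
    \<in> {\<Sum>i<n. D (f i) (f (Suc i)) | f n. f 0 = x \<and> f n = y \<and> (\<forall>i. f i \<in> X)}"
    by (rule CollectI, rule exI[of _ ?f], rule exI[of _ 1]) (use assms in auto)
  then show ?thesis by blast
qed

lemma chain_dist_triangle:
  assumes x: "x \<in> X" and y: "y \<in> X" and z: "z \<in> X"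
  shows "chain_dist X D x z \<le> chain_dist X D x y + D y z"
proof -
  have "chain_dist X D x z - D y z \<le> chain_dist X D x y"
    unfolding chain_dist_def[of X D x y]
  proof (rule cInf_greatest[OF chain_sums_nonempty[OF x y]])
    fix s assume "s \<in> {\<Sum>i<n. D (f i) (f (Suc i)) | f n.
      f 0 = x \<and> f n = y \<and> (\<forall>i. f i \<in> X)}"
    then obtain f n where f: "s = (\<Sum>i<n. D (f i) (f (Suc i)))" "f 0 = x" "f n = y" "\<forall>i. f i \<in> X"
      by blast
    define f' where "f' i = (if i \<le> n then f i else z)" for i
    have "(\<Sum>i<Suc n. D (f' i) (f' (Suc i))) = s + D y z"
      using f by (simp add: f'_def)
    moreover have "chain_dist X D x z \<le> (\<Sum>i<Suc n. D (f' i) (f' (Suc i)))"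
      unfolding chain_dist_def
      by (intro cInf_lower chain_sums_bdd_below CollectI exI[of _ f'] exI[of _ "Suc n"])
        (use f z in \<open>auto simp: f'_def\<close>)
    ultimately show "chain_dist X D x z - D y z \<le> s" by simp
  qed
  then show ?thesis by simp
qed

text \<open>
  Shortening by detours loses at most a factor 4, so that \<open>chain_dist\<close> restores the triangle
  inequality without becoming degenerate.
\<close>
lemma le_four_chain_dist:
  assumes quasi: "\<And>x y z. x \<in> X \<Longrightarrow> y \<in> X \<Longrightarrow> z \<in> X \<Longrightarrow> D x y \<le> 2 * max (D x z) (D z y)"
    and refl: "\<And>x. x \<in> X \<Longrightarrow> D x x = 0"
    and x: "x \<in> X" and y: "y \<in> X"
  shows "D x y \<le> 4 * chain_dist X D x y"
proof -
  have "D x y / 4 \<le> chain_dist X D x y"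
    unfolding chain_dist_def[of X D x y]
  proof (rule cInf_greatest[OF chain_sums_nonempty[OF x y]])
    fix s assume "s \<in> {\<Sum>i<n. D (f i) (f (Suc i)) | f n.
      f 0 = x \<and> f n = y \<and> (\<forall>i. f i \<in> X)}"
    then obtain f n where f: "s = (\<Sum>i<n. D (f i) (f (Suc i)))" "f 0 = x" "f n = y"
      and fX: "\<And>i. f i \<in> X"
      by blast
    consider "n = 0" | "n = 1" | "0 + 2 \<le> n" by linarith
    then show "D x y / 4 \<le> s"
    proof cases
      case 1
      then show ?thesis using f x refl by simp
    next
      case 2
      then show ?thesis using f D_nonneg[OF x y] by simp
    next
      case 3
      have "D (f 0) (f n) + 2 * D (f 0) (f (Suc 0)) + 2 * D (f (n - 1)) (f n)
          \<le> 4 * (\<Sum>i\<in>{0..<n}. D (f i) (f (Suc i)))"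
        by (rule frink_chain_inequality[OF D_nonneg quasi fX 3])
      moreover have "0 \<le> D (f 0) (f (Suc 0))" "0 \<le> D (f (n - 1)) (f n)"
        by (auto intro!: D_nonneg fX)
      ultimately show ?thesis using f by (simp add: atLeast0LessThan)
    qed
  qed
  then show ?thesis by simp
qed

end

section \<open>Hoelder functions from the smoothness index\<close>

text \<open>
  Here the role of attainment becomes visible: an exponent strictly below the supremum, or equal to
  an attained one, is dominated by the exponent of a single equivalent quasi-metric \<open>\<rho>\<close>. Its
  power \<open>\<rho> powr \<alpha>\<close> then has constant at most 2, the threshold in Frink's inequality.
\<close>
lemma admissible_smoothnessE:
  assumes "admissible_smoothness \<alpha> X d" "0 < \<alpha>"
  obtains \<rho> where "quasi_metric_on X \<rho>" "quasi_metric_equiv X \<rho> d"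
    "quasi_metric_const X \<rho> powr \<alpha> \<le> 2"
proof -
  have "\<exists>\<rho>. quasi_metric_on X \<rho> \<and> quasi_metric_equiv X \<rho> d \<and> ereal \<alpha> \<le> smoothness_exponent X \<rho>"
  proof (cases "ereal \<alpha> = lower_smoothness_index X d")
    case True
    then show ?thesis using assms unfolding admissible_smoothness_def by (metis order_refl)
  next
    case False
    then have "ereal \<alpha> < lower_smoothness_index X d"
      using assms unfolding admissible_smoothness_def by (simp add: order_le_neq_trans)
    then show ?thesis unfolding lower_smoothness_index_def less_SUP_iff
      by (auto intro: less_imp_le)
  qed
  then obtain \<rho> where \<rho>: "quasi_metric_on X \<rho>" "quasi_metric_equiv X \<rho> d"
    and le: "ereal \<alpha> \<le> smoothness_exponent X \<rho>" by blast
  let ?C = "quasi_metric_const X \<rho>"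
  have C: "1 \<le> ?C" by (rule quasi_metric_const_ge_1[OF \<rho>(1)])
  \<comment> \<open>For \<open>log 2 ?C = 0\<close> the exponent is infinite and gives no information, but none is required.\<close>
  have "\<alpha> * log 2 ?C \<le> 1"
  proof (cases "log 2 ?C = 0")
    case False
    moreover have "0 \<le> log 2 ?C" using C by simp
    ultimately have "0 < log 2 ?C" by linarith
    moreover have "\<alpha> \<le> inverse (log 2 ?C)"
      using le False unfolding smoothness_exponent_def by simp
    ultimately show ?thesis by (simp add: field_simps)
  qed simp
  have "?C powr \<alpha> = (2 powr log 2 ?C) powr \<alpha>" using C by simp
  also have "\<dots> = 2 powr (\<alpha> * log 2 ?C)" by (simp add: powr_powr mult.commute)
  also have "\<dots> \<le> 2 powr 1" using \<open>\<alpha> * log 2 ?C \<le> 1\<close> by (intro powr_mono) auto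
  finally show ?thesis using that[OF \<rho>] by simp
qed

text \<open>
  The chain distance of \<open>\<rho> powr \<alpha>\<close> from a base point replaces the function \<open>d x0\<close>, which need not
  be Hoelder continuous. It is \<open>\<alpha>\<close>-Hoelder by the triangle inequality, and its
  sublevel sets lie in balls.
\<close>
lemma admissible_smoothness_Hoelder_distance:
  assumes qm: "quasi_metric_on X d" and adm: "admissible_smoothness \<alpha> X d" and \<alpha>: "0 < \<alpha>"
    and x0: "x0 \<in> X"
  obtains \<Phi> K c where "0 < K" "0 < c"
    "\<And>x y. x \<in> X \<Longrightarrow> y \<in> X \<Longrightarrow> \<bar>\<Phi> x - \<Phi> y\<bar> \<le> K * d x y powr \<alpha>"
    "\<And>x. x \<in> X \<Longrightarrow> d x0 x powr \<alpha> \<le> c * \<Phi> x"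
proof -
  obtain \<rho> where \<rho>: "quasi_metric_on X \<rho>" "quasi_metric_equiv X \<rho> d"
    and C2: "quasi_metric_const X \<rho> powr \<alpha> \<le> 2"
    using admissible_smoothnessE[OF adm \<alpha>] by blast
  obtain \<kappa> where \<kappa>: "0 < \<kappa>" and
    eq: "\<And>x y. x \<in> X \<Longrightarrow> y \<in> X \<Longrightarrow> inverse \<kappa> * \<rho> x y \<le> d x y \<and> d x y \<le> \<kappa> * \<rho> x y"
    using \<rho>(2) unfolding quasi_metric_equiv_def by blast
  obtain C0 where C0: "0 < C0" "\<And>x y. x \<in> X \<Longrightarrow> y \<in> X \<Longrightarrow> d y x \<le> C0 * d x y"
    using quasi_metric_onE[OF qm] by metis
  note d0 = quasi_metric_on_nonneg[OF qm]
  note \<rho>0 = quasi_metric_on_nonneg[OF \<rho>(1)]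
  define D where "D x y = \<rho> x y powr \<alpha>" for x y
  have D_nonneg: "0 \<le> D x y" for x y by (simp add: D_def)
  have D_quasi: "D x y \<le> 2 * max (D x z) (D z y)" if xyz: "x \<in> X" "y \<in> X" "z \<in> X" for x y z
  proof -
    let ?m = "max (\<rho> x z) (\<rho> z y)"
    have m: "0 \<le> ?m" using \<rho>0[of x z] xyz by (simp add: le_max_iff_disj)
    have "D x y \<le> (quasi_metric_const X \<rho> * ?m) powr \<alpha>"
      unfolding D_def using xyz \<alpha> quasi_metric_const_ineq[OF \<rho>(1) xyz]
      by (intro powr_mono2 \<rho>0) auto
    also have "\<dots> = quasi_metric_const X \<rho> powr \<alpha> * ?m powr \<alpha>"
      by (rule powr_mult)
    also have "\<dots> \<le> 2 * ?m powr \<alpha>" using C2 by (intro mult_right_mono) auto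
    also have "?m powr \<alpha> \<le> max (D x z) (D z y)"
      unfolding D_def by (auto simp: max_def)
    finally show ?thesis by simp
  qed
  have D_self: "D x x = 0" if "x \<in> X" for x
    using quasi_metric_on_self[OF \<rho>(1) that] \<alpha> by (simp add: D_def)
  \<comment> \<open>The factor \<open>C0\<close> pays for the asymmetry of \<open>d\<close>: both \<open>D x y\<close> and \<open>D y x\<close> have to be
    bounded by \<open>d x y\<close>, since the triangle inequality for chains is used in both directions.\<close>
  define \<Phi> where "\<Phi> = chain_dist X D x0"
  define K where "K = (\<kappa> * max 1 C0) powr \<alpha>"
  have DK: "D x y \<le> K * d x y powr \<alpha>" "D y x \<le> K * d x y powr \<alpha>"
    if xy: "x \<in> X" "y \<in> X" for x y
  proof -
    have a: "\<rho> x y \<le> \<kappa> * d x y" "\<rho> y x \<le> \<kappa> * d y x"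
      using eq[OF xy] eq[OF xy(2) xy(1)] \<kappa> by (simp_all add: field_simps)
    have "1 * d x y \<le> max 1 C0 * d x y" "C0 * d x y \<le> max 1 C0 * d x y"
      by (rule mult_right_mono[OF _ d0[OF xy]], simp)+
    then have "d x y \<le> max 1 C0 * d x y" "d y x \<le> max 1 C0 * d x y"
      using C0(2)[OF xy] by auto
    then have "\<kappa> * d x y \<le> \<kappa> * (max 1 C0 * d x y)" "\<kappa> * d y x \<le> \<kappa> * (max 1 C0 * d x y)"
      using \<kappa> by auto
    then have b: "\<rho> x y \<le> (\<kappa> * max 1 C0) * d x y" "\<rho> y x \<le> (\<kappa> * max 1 C0) * d x y"
      using a by (auto simp: mult.assoc)
    have K: "((\<kappa> * max 1 C0) * d x y) powr \<alpha> = K * d x y powr \<alpha>"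
      unfolding K_def by (rule powr_mult)
    have "D x y \<le> ((\<kappa> * max 1 C0) * d x y) powr \<alpha>" "D y x \<le> ((\<kappa> * max 1 C0) * d x y) powr \<alpha>"
      unfolding D_def using b xy \<alpha> by (auto intro!: powr_mono2 \<rho>0)
    then show "D x y \<le> K * d x y powr \<alpha>" "D y x \<le> K * d x y powr \<alpha>"
      unfolding K by auto
  qed
  show ?thesis
  proof (rule that[of K "4 * \<kappa> powr \<alpha>" \<Phi>])
    show "0 < K" using \<kappa> by (simp add: K_def)
    show "0 < 4 * \<kappa> powr \<alpha>" using \<kappa> by simp
    show "\<bar>\<Phi> x - \<Phi> y\<bar> \<le> K * d x y powr \<alpha>" if xy: "x \<in> X" "y \<in> X" for x y
    proof -
      have "\<Phi> y \<le> \<Phi> x + D x y" "\<Phi> x \<le> \<Phi> y + D y x"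
        unfolding \<Phi>_def using x0 xy by (intro chain_dist_triangle D_nonneg; simp)+
      then show ?thesis using DK[OF xy] by linarith
    qed
    show "d x0 x powr \<alpha> \<le> 4 * \<kappa> powr \<alpha> * \<Phi> x" if x: "x \<in> X" for x
    proof -
      have "d x0 x powr \<alpha> \<le> (\<kappa> * \<rho> x0 x) powr \<alpha>"
        using eq[OF x0 x] d0[OF x0 x] \<alpha> by (intro powr_mono2) auto
      also have "\<dots> = \<kappa> powr \<alpha> * D x0 x"
        using \<kappa> \<rho>0[OF x0 x] by (simp add: powr_mult D_def)
      also have "D x0 x \<le> 4 * \<Phi> x"
        unfolding \<Phi>_def using D_quasi D_self x0 x
        by (intro le_four_chain_dist D_nonneg)
      finally show ?thesis using \<kappa> by (simp add: mult.assoc mult.left_commute)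
    qed
  qed
qed

lemma Hoelder_sublevel_measurable:
  assumes qmms: "quasi_metric_measure_space M d" and \<alpha>: "0 < \<alpha>" and K: "0 < K"
    and hoelder: "\<And>x y. x \<in> space M \<Longrightarrow> y \<in> space M \<Longrightarrow> \<bar>\<Phi> x - \<Phi> y\<bar> \<le> K * d x y powr \<alpha>"
  shows "{x \<in> space M. \<Phi> x < t} \<in> sets M"
proof -
  have qm: "quasi_metric_on (space M) d"
    using qmms by (simp add: quasi_metric_measure_space_def)
  have "openin (quasi_metric_topology (space M) d) {x \<in> space M. \<Phi> x < t}"
    unfolding openin_quasi_metric_topology
  proof (intro conjI ballI)
    fix x assume "x \<in> {x \<in> space M. \<Phi> x < t}"
    then have x: "x \<in> space M" "\<Phi> x < t" by auto
    define r where "r = ((t - \<Phi> x) / K) powr (1 / \<alpha>)"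
    have "0 < r" using x K by (simp add: r_def)
    moreover have "qball (space M) d x r \<subseteq> {x \<in> space M. \<Phi> x < t}"
    proof
      fix y assume "y \<in> qball (space M) d x r"
      then have y: "y \<in> space M" "d x y < r" by (auto simp: qball_def)
      have "d x y powr \<alpha> < r powr \<alpha>"
        using y \<alpha> quasi_metric_on_nonneg[OF qm x(1) y(1)] by (intro powr_less_mono2) auto
      also have "r powr \<alpha> = (t - \<Phi> x) / K" using x K \<alpha> by (simp add: r_def powr_powr)
      finally have "K * d x y powr \<alpha> < t - \<Phi> x" using K by (simp add: field_simps)
      then show "y \<in> {x \<in> space M. \<Phi> x < t}" using hoelder[OF x(1) y(1)] y by simp
    qed
    ultimately show "\<exists>r>0. qball (space M) d x r \<subseteq> {x \<in> space M. \<Phi> x < t}" by blast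
  qed auto
  then have "{x \<in> space M. \<Phi> x < t}
      \<in> sigma_sets (space M) {U. openin (quasi_metric_topology (space M) d) U}"
    by (intro sigma_sets.Basic) simp
  then show ?thesis using qmms unfolding quasi_metric_measure_space_def by blast
qed

section \<open>Growth of the volume\<close>

text \<open>
  Since \<open>p / q > 1\<close>, each step raises a large volume to a power greater than 1, at the price of a
  polynomial factor in the inverse step length. With steps \<open>1/2, 1/4, 1/8, ...\<close> this price is
  only exponential in the number of steps, so a volume above a fixed threshold would grow without
  bound before the radius has increased by 1.
\<close>
lemma superlinear_iteration_bounded:
  fixes V :: "real \<Rightarrow> real"
  assumes V: "mono V" "\<And>t. 0 \<le> V t" and "0 < L" "0 < q" "q < p"
    and step: "\<And>t e. 0 < e \<Longrightarrow> e \<le> 1 \<Longrightarrow> V t \<le> (L / e * V (t + e) powr (1 / p)) powr q"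
  obtains A where "\<And>t. V t \<le> A"
proof -
  define s where "s = p / q"
  have s: "s > 1" using assms by (simp add: s_def)
  \<comment> \<open>\<open>B\<close> absorbs the loss \<open>2 powr (p * j)\<close> of the step of length \<open>(1 / 2) ^ (j + 1)\<close>, and \<open>A\<close>
    absorbs the constants; both rely on \<open>s > 1\<close>.\<close>
  define B where "B = 2 powr (p / (s - 1))"
  define A where "A = ((2 * L) powr p * B) powr (1 / (s - 1))"
  have B: "B > 1" using s assms by (auto simp: B_def)
  have A: "A > 0" using B assms by (auto simp: A_def)
  have As: "A powr s = A * ((2 * L) powr p * B)"
  proof -
    have "A powr s = A powr 1 * A powr (s - 1)" by (subst powr_add[symmetric]) simp
    also have "A powr (s - 1) = (2 * L) powr p * B"
      using s B assms unfolding A_def by (simp add: powr_powr)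
    finally show ?thesis using A by simp
  qed
  have Bs: "(B ^ j) powr s = B ^ j * 2 powr (p * real j)" for j
  proof -
    have "(B ^ j) powr s = (B powr real j) powr (1 + (s - 1))"
      using B by (simp add: powr_realpow)
    also have "\<dots> = B powr real j * B powr ((s - 1) * real j)"
      by (simp add: powr_powr algebra_simps flip: powr_add)
    also have "B powr ((s - 1) * real j) = 2 powr (p * real j)"
      using s by (simp add: B_def powr_powr)
    finally show ?thesis using B by (simp add: powr_realpow)
  qed
  have "V t \<le> A" for t
  proof (rule ccontr)
    assume "\<not> V t \<le> A"
    define r where "r j = t + 1 - (1 / 2) ^ j" for j :: nat
    have grow: "A * B ^ j \<le> V (r j)" for j
    proof (induction j)
      case 0
      then show ?case using \<open>\<not> V t \<le> A\<close> by (simp add: r_def)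
    next
      case (Suc j)
      let ?e = "(1 / 2 :: real) ^ Suc j"
      let ?W = "V (r (Suc j))"
      have "r j + ?e = r (Suc j)" by (simp add: r_def)
      moreover have "?e \<le> 1" by (intro power_le_one) auto
      ultimately have "V (r j) \<le> (L / ?e * ?W powr (1 / p)) powr q"
        using step[of ?e "r j"] by simp
      then have "A * B ^ j \<le> (L / ?e * ?W powr (1 / p)) powr q"
        using Suc.IH by linarith
      then have "(A * B ^ j) powr s \<le> ((L / ?e * ?W powr (1 / p)) powr q) powr s"
        using A B s by (intro powr_mono2) auto
      also have "\<dots> = (L / ?e * ?W powr (1 / p)) powr p"
        using assms by (simp add: powr_powr s_def)
      also have "\<dots> = (2 * L) powr p * (2 powr (p * real j) * ?W)"
      proof -
        have "L / ?e * ?W powr (1 / p) = (2 * L) * (2 powr real j * ?W powr (1 / p))"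
          by (simp add: powr_realpow field_simps)
        then show ?thesis
          using assms V(2)[of "r (Suc j)"] by (simp add: powr_mult powr_powr mult.commute)
      qed
      finally have "(A * ((2 * L) powr p * B)) * (B ^ j * 2 powr (p * real j))
          \<le> (2 * L) powr p * (2 powr (p * real j) * ?W)"
        using A B by (simp add: powr_mult As Bs)
      then have "((2 * L) powr p * 2 powr (p * real j)) * (A * B ^ Suc j)
          \<le> ((2 * L) powr p * 2 powr (p * real j)) * ?W"
        by (simp add: ac_simps)
      then show ?case
        using assms by (subst (asm) mult_le_cancel_left_pos) auto
    qed
    obtain j where "V (t + 1) / A < B ^ j" using B real_arch_pow by blast
    then have "V (t + 1) < A * B ^ j" using A by (simp add: field_simps)
    also have "\<dots> \<le> V (r j)" by (rule grow)
    also have "\<dots> \<le> V (t + 1)" by (intro monoD[OF V(1)]) (simp add: r_def)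
    finally show False by simp
  qed
  then show ?thesis using that by blast
qed

lemma cutoff_Lipschitz:
  fixes a b t e :: real
  assumes "0 < e"
  shows "\<bar>max 0 (min 1 ((t + e - a) / e)) - max 0 (min 1 ((t + e - b) / e))\<bar> \<le> \<bar>a - b\<bar> / e"
proof -
  have "\<bar>max 0 (min 1 x) - max 0 (min 1 y)\<bar> \<le> \<bar>x - y\<bar>" for x y :: real
    by (auto simp: max_def min_def)
  also have "\<bar>(t + e - a) / e - (t + e - b) / e\<bar> = \<bar>a - b\<bar> / e"
    using assms by (simp add: abs_minus_commute flip: diff_divide_distrib)
  finally show ?thesis .
qed

text \<open>
  Testing the embedding on a cutoff between two sublevel sets of the Hoelder function \<open>\<Phi>\<close> bounds the
  volume \<open>V t\<close> by powers of \<open>V (t + e)\<close> and of the inverse of \<open>e\<close>; iteration over small \<open>e\<close> bounds \<open>V\<close>.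
\<close>
lemma finite_measure_of_continuous_embedding:
  assumes qmms: "quasi_metric_measure_space M d"
    and q: "0 < q" "q < p" and \<alpha>: "0 < \<alpha>" and adm: "admissible_smoothness \<alpha> (space M) d"
    and emb: "continuous_embedding (hajlasz_space M d \<alpha> p) (hajlasz_norm M d \<alpha> p)
                (Lp_space M q) (Lp_norm M q)"
  shows "emeasure M (space M) < \<infinity>"
proof -
  have qm: "quasi_metric_on (space M) d"
    using qmms by (simp add: quasi_metric_measure_space_def)
  have p: "0 < p" using q by simp
  obtain x0 where x0: "x0 \<in> space M" using conjunct1[OF qm[unfolded quasi_metric_on_def]] by blast
  obtain K c \<Phi> where K: "0 < K" and c: "0 < c"
    and hoelder: "\<And>x y. x \<in> space M \<Longrightarrow> y \<in> space M \<Longrightarrow> \<bar>\<Phi> x - \<Phi> y\<bar> \<le> K * d x y powr \<alpha>"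
    and coercive: "\<And>x. x \<in> space M \<Longrightarrow> d x0 x powr \<alpha> \<le> c * \<Phi> x"
    by (rule admissible_smoothness_Hoelder_distance[OF qm adm \<alpha> x0]) (rule that, assumption+)
  define A where "A t = {x \<in> space M. \<Phi> x < t}" for t
  have A[measurable]: "A t \<in> sets M" for t
    unfolding A_def by (rule Hoelder_sublevel_measurable[OF qmms \<alpha> K hoelder])
  have \<Phi>[measurable]: "\<Phi> \<in> borel_measurable M"
    using A unfolding A_def borel_measurable_iff_less by blast
  have A_finite: "emeasure M (A t) < \<infinity>" for t
  proof -
    define r where "r = (c * max 1 t) powr (1 / \<alpha>)"
    have r: "0 < r" using c by (simp add: r_def)
    have "A t \<subseteq> qball (space M) d x0 r"
    proof
      fix x assume "x \<in> A t"
      then have x: "x \<in> space M" "\<Phi> x < t" by (auto simp: A_def)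
      have "d x0 x powr \<alpha> \<le> c * \<Phi> x" by (rule coercive[OF x(1)])
      also have "\<dots> < c * max 1 t" using x c by simp
      finally have "d x0 x powr \<alpha> < r powr \<alpha>" using c \<alpha> by (simp add: r_def powr_powr)
      then have "d x0 x < r"
        using \<alpha> r powr_mono2[of \<alpha> r "d x0 x"] by linarith
      then show "x \<in> qball (space M) d x0 r" using x by (simp add: qball_def)
    qed
    then have "emeasure M (A t) \<le> emeasure M (qball (space M) d x0 r)"
      using qmms x0 r unfolding quasi_metric_measure_space_def by (intro emeasure_mono) auto
    also have "\<dots> < \<infinity>"
      using qmms x0 r unfolding quasi_metric_measure_space_def by auto
    finally show ?thesis .
  qed
  define V where "V t = measure M (A t)" for t
  have emeasure_A: "emeasure M (A t) = ennreal (V t)" for t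
    using A_finite[of t] by (simp add: V_def emeasure_eq_ennreal_measure)
  have V0: "0 \<le> V t" for t by (simp add: V_def)
  have "mono V"
  proof (rule monoI)
    fix s t :: real assume "s \<le> t"
    then have "emeasure M (A s) \<le> emeasure M (A t)"
      by (intro emeasure_mono A) (auto simp: A_def)
    then show "V s \<le> V t" using V0 by (simp add: emeasure_A ennreal_le_iff)
  qed
  obtain C where C: "0 \<le> C" and emb_bound:
    "\<And>u. u \<in> hajlasz_space M d \<alpha> p \<Longrightarrow> Lp_norm M q u \<le> ennreal C * hajlasz_norm M d \<alpha> p u"
    using emb unfolding continuous_embedding_def by blast
  define L where "L = (C + 1) * (1 + K)"
  have L: "0 < L" using C K by (simp add: L_def)
  have step: "V t \<le> (L / e * V (t + e) powr (1 / p)) powr q" if e: "0 < e" "e \<le> 1" for t e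
  proof -
    \<comment> \<open>\<open>u\<close> is \<open>1\<close> on \<open>A t\<close> and vanishes off \<open>A (t + e)\<close>; its gradient can be supported on the
      larger set because two points outside it have the same value.\<close>
    define u where "u x = max 0 (min 1 ((t + e - \<Phi> x) / e))" for x
    define g where "g x = K / e * indicator (A (t + e)) x" for x
    let ?W = "V (t + e) powr (1 / p)"
    have u_meas[measurable]: "u \<in> borel_measurable M" unfolding u_def by measurable
    have [measurable]: "g \<in> borel_measurable M" unfolding g_def by measurable
    have u_supp: "u x = 0" if "x \<in> space M" "x \<notin> A (t + e)" for x
    proof -
      have "(t + e - \<Phi> x) / e \<le> 0"
        using that e by (intro divide_nonpos_pos) (auto simp: A_def)
      then show ?thesis by (simp add: u_def)
    qed
    have u_bound: "\<bar>u x\<bar> \<le> 1 * indicator (A (t + e)) x" if "x \<in> space M" for x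
      using u_supp[OF that] by (cases "x \<in> A (t + e)") (auto simp: u_def)
    have norm_u: "Lp_norm M p u \<le> ennreal (1 * ?W)"
      unfolding V_def
      by (rule Lp_norm_le_of_bounded_support[OF p _ A A_finite u_bound]) auto
    have norm_g: "Lp_norm M p g \<le> ennreal (K / e * ?W)"
      unfolding V_def
      by (rule Lp_norm_le_of_bounded_support[OF p _ A A_finite]) (use K e in \<open>auto simp: g_def\<close>)
    have grad: "g \<in> hajlasz_gradients M d \<alpha> u"
    proof -
      have "\<bar>u x - u y\<bar> \<le> d x y powr \<alpha> * (g x + g y)" if x: "x \<in> space M" and y: "y \<in> space M" for x y
      proof (cases "x \<in> A (t + e) \<or> y \<in> A (t + e)")
        case True
        have "\<bar>u x - u y\<bar> \<le> \<bar>\<Phi> x - \<Phi> y\<bar> / e" unfolding u_def by (rule cutoff_Lipschitz[OF e(1)])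
        also have "\<dots> \<le> K * d x y powr \<alpha> / e"
          using hoelder[OF x y] e by (intro divide_right_mono) auto
        also have "\<dots> = d x y powr \<alpha> * (K / e)" by simp
        also have "\<dots> \<le> d x y powr \<alpha> * (g x + g y)"
          using True K e by (intro mult_left_mono) (auto simp: g_def)
        finally show ?thesis .
      next
        case False
        then show ?thesis using u_supp x y by (simp add: g_def)
      qed
      then show ?thesis
        unfolding hajlasz_gradients_def using K e by (auto simp: g_def intro!: bexI[of _ "{}"])
    qed
    have "(INF g\<in>hajlasz_gradients M d \<alpha> u. Lp_norm M p g) \<le> ennreal (K / e * ?W)"
      using INF_lower[OF grad, of "Lp_norm M p"] norm_g by (rule order_trans)
    then have "hajlasz_norm M d \<alpha> p u \<le> ennreal (1 * ?W) + ennreal (K / e * ?W)"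
      unfolding hajlasz_norm_def using norm_u by (rule add_mono[rotated])
    also have "\<dots> = ennreal ((1 + K / e) * ?W)"
      using K e by (simp add: distrib_right flip: ennreal_plus)
    finally have hn: "hajlasz_norm M d \<alpha> p u \<le> ennreal ((1 + K / e) * ?W)" .
    have "u \<in> hajlasz_space M d \<alpha> p"
      unfolding hajlasz_space_def Lp_space_def using hn norm_u
      by (auto simp: le_less_trans[OF _ ennreal_less_top])
    then have "Lp_norm M q u \<le> ennreal C * hajlasz_norm M d \<alpha> p u" by (rule emb_bound)
    also have "\<dots> \<le> ennreal C * ennreal ((1 + K / e) * ?W)"
      using hn by (intro mult_left_mono) auto
    also have "\<dots> = ennreal (C * (1 + K / e) * ?W)"
      using C K e by (simp add: mult.assoc flip: ennreal_mult)
    also have "\<dots> \<le> ennreal (L / e * ?W)"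
    proof (intro ennreal_leI mult_right_mono)
      have "C * (1 + K / e) \<le> (C + 1) * ((1 + K) / e)"
        using C K e by (intro mult_mono) (auto simp: field_simps)
      then show "C * (1 + K / e) \<le> L / e" by (simp add: L_def)
    qed auto
    finally have "(\<integral>\<^sup>+x. ennreal (\<bar>u x\<bar> powr q) \<partial>M) \<le> ennreal ((L / e * ?W) powr q)"
      using L e q by (subst (asm) Lp_norm_le_iff) auto
    moreover have "emeasure M (A t) \<le> (\<integral>\<^sup>+x. ennreal (\<bar>u x\<bar> powr q) \<partial>M)"
    proof -
      have "(\<integral>\<^sup>+x. indicator (A t) x \<partial>M) \<le> (\<integral>\<^sup>+x. ennreal (\<bar>u x\<bar> powr q) \<partial>M)"
      proof (intro nn_integral_mono)
        fix x
        show "indicator (A t) x \<le> ennreal (\<bar>u x\<bar> powr q)"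
        proof (cases "x \<in> A t")
          case True
          then have "u x = 1" using e by (auto simp: u_def A_def field_simps)
          then show ?thesis by (simp add: indicator_def)
        qed simp
      qed
      then show ?thesis by simp
    qed
    ultimately have "ennreal (V t) \<le> ennreal ((L / e * ?W) powr q)"
      unfolding emeasure_A by (rule order_trans[rotated])
    then show ?thesis by (simp add: ennreal_le_iff)
  qed
  obtain B where B: "\<And>t. V t \<le> B"
    using superlinear_iteration_bounded[OF \<open>mono V\<close> V0 L q step] by blast
  have space_eq: "space M = (\<Union>n. A (real n))"
  proof (intro equalityI subsetI)
    fix x assume "x \<in> space M"
    moreover obtain n where "\<Phi> x < real n" using reals_Archimedean2 by blast
    ultimately show "x \<in> (\<Union>n. A (real n))" by (auto simp: A_def)
  qed (auto simp: A_def)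
  have "emeasure M (space M) = (SUP n. emeasure M (A (real n)))"
    unfolding space_eq
    by (rule SUP_emeasure_incseq[symmetric]) (auto simp: A_def incseq_def intro: less_le_trans)
  also have "\<dots> \<le> ennreal B"
    by (rule SUP_least) (simp add: emeasure_A B ennreal_leI)
  also have "\<dots> < \<infinity>" by simp
  finally show ?thesis .
qed

section \<open>The embedding theorem\<close>

theorem theorem1p3:
  fixes M :: "'a measure" and d :: "'a \<Rightarrow> 'a \<Rightarrow> real"
  assumes "quasi_metric_measure_space M d"
  shows "(emeasure M (space M) < \<infinity> \<longrightarrow>
           (\<forall>\<alpha>>0. \<forall>p>0. \<forall>q. 0 < q \<and> q < p \<longrightarrow>
              compact_embedding (hajlasz_space M d \<alpha> p) (hajlasz_norm M d \<alpha> p)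
                                (Lp_space M q) (Lp_norm M q))) \<and>
         ((\<exists>p>0. \<exists>q. 0 < q \<and> q < p \<and>
             (\<exists>\<alpha>>0. admissible_smoothness \<alpha> (space M) d \<and>
                continuous_embedding (hajlasz_space M d \<alpha> p) (hajlasz_norm M d \<alpha> p)
                                     (Lp_space M q) (Lp_norm M q))) \<longrightarrow>
           emeasure M (space M) < \<infinity>)"
  using compact_embedding_of_finite_measure[OF assms] finite_measure_of_continuous_embedding[OF assms]
  by blast

end
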